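(* Let $X$ be a non-empty finite set, let $C$ be a family of subsets of $X$ with $|C|\ge 2$, let $Z=X\times\{0,1\}$, and let $c\models(x,b)$ if and only if ($b=1$ and $x\in c$) or ($b=0$ and $x\notin c$). Then $$\mathrm{MLE\text{-}TD}(C)\le\mathrm{AN}(C)\quad\text{and}\quad\mathrm{MLE\text{-}TD}(C)\le\mathrm{NC\text{-}TD}(C).$$
   Context: For $A\subseteq Z$, $c\models A$ ("$c$ is consistent with $A$") means $c\models z$ for all $z\in A$. The order of a map $T:C\to 2^Z$ is $\max_{c\in C}|T(c)|$. $\mathrm{MLE\text{-}TD}(C)$ here refers to unordered sampling without replacement and is defined as follows. For a probability vector $Q=(q(z))_{z\in Z}$ and a set $A=\{z_1,\dots,z_n\}\subseteq Z$ of size $n\le|\{z:q(z)>0\}|$, $P^{\overline{O},\overline{R}}(A|Q)=\sum_\sigma\prod_{i=1}^n \frac{q(z_{\sigma(i)})}{1-(q(z_{\sigma(1)})+\dots+q(z_{\sigma(i-1)}))}$ over all permutations $\sigma$ of $\{1,\dots,n\}$ (equal to $1$ for $A=\emptyset$). An MLE-learner $L$ for $C$ is given by conditional likelihoods $P(z|c)\ge 0$ with $\sum_{z\in Z}P(z|c)=1$ for each $c\in C$, such that $c\not\models z$ implies $P(z|c)=0$. Let $N^+(C,L)=\min_{c\in C}|\{z\in Z:P(z|c)>0\}|$. A teacher for $L$ is a map $T:C\to 2^Z$ such that for every $c_0\in C$: $|T(c_0)|\le N^+(C,L)$ and $c_0$ is the unique maximizer over $c\in C$ of $P^{\overline{O},\overline{R}}(T(c_0)|P(\cdot|c))$.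 $\mathrm{MLE\text{-}TD}(C)$ is the smallest $d$ such that some MLE-learner for $C$ has a teacher of order $d$. An antichain mapping for $C$ is a map $T:C\to 2^Z$ with $c\models T(c)$ for all $c\in C$ and $T(c_1)\not\subseteq T(c_2)$ for all $c_1\neq c_2$ in $C$. The antichain number $\mathrm{AN}(C)$ is the smallest possible order of an antichain mapping for $C$. A map $T:C\to 2^Z$ is clash-free on $C$ if $c\models T(c)$ for all $c\in C$ and, for all $c_1\neq c_2$ in $C$, $c_1$ is inconsistent with $T(c_2)$ or $c_2$ is inconsistent with $T(c_1)$. The no-clash teaching dimension $\mathrm{NC\text{-}TD}(C)$ is the smallest possible order of a map that is clash-free on $C$. *)

theory Defs
  imports
    Complex_Main
    "HOL-Library.FuncSet"
    "HOL-Library.Extended_Nat"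
    "HOL-Combinatorics.Multiset_Permutations"
begin

text \<open>
  The notions below are relative to an example set \<open>Z\<close>, a concept class \<open>C\<close> and a consistency
  relation \<open>cons\<close>, where \<open>cons c z\<close> stands for \<open>c \<Turnstile> z\<close>. The three dimensions take values in
  \<^typ>\<open>enat\<close>, so that a dimension is \<open>\<infinity>\<close> if there is no mapping of the required kind;
  otherwise the infimum is an attained minimum.
\<close>

definition consistent_with :: "('c \<Rightarrow> 'z \<Rightarrow> bool) \<Rightarrow> 'c \<Rightarrow> 'z set \<Rightarrow> bool" where
  "consistent_with cons c A \<longleftrightarrow> (\<forall>z\<in>A. cons c z)"

definition map_order :: "'c set \<Rightarrow> ('c \<Rightarrow> 'z set) \<Rightarrow> nat" where
  "map_order C T = Max ((\<lambda>c. card (T c)) ` C)"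

text \<open>
  The likelihood of the unordered sample \<open>A\<close> when sampling without replacement according to \<open>q\<close>.
  The sum over all permutations of the indices of \<open>A = {z\<^sub>1, \<dots>, z\<^sub>n}\<close> is written as a sum over all
  repetition-free enumerations of \<open>A\<close>. The value is meaningful only if \<open>card A\<close> is at most the
  size of the support of the probability vector \<open>q\<close>; in that case no denominator vanishes.
\<close>

definition sample_likelihood :: "('z \<Rightarrow> real) \<Rightarrow> 'z set \<Rightarrow> real" where
  "sample_likelihood q A =
     (\<Sum>zs\<in>permutations_of_set A. \<Prod>i<length zs. q (zs ! i) / (1 - (\<Sum>j<i. q (zs ! j))))"

text \<open>Here \<open>P c z\<close> is the conditional likelihood of \<open>z\<close> given \<open>c\<close>.\<close>

definition mle_learner ::
    "'z set \<Rightarrow> ('c \<Rightarrow> 'z \<Rightarrow> bool) \<Rightarrow> 'c set \<Rightarrow> ('c \<Rightarrow> 'z \<Rightarrow> real) \<Rightarrow> bool" where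
  "mle_learner Z cons C P \<longleftrightarrow>
     (\<forall>c\<in>C. (\<forall>z\<in>Z. P c z \<ge> 0) \<and> (\<Sum>z\<in>Z. P c z) = 1 \<and> (\<forall>z\<in>Z. \<not> cons c z \<longrightarrow> P c z = 0))"

definition N_plus :: "'z set \<Rightarrow> 'c set \<Rightarrow> ('c \<Rightarrow> 'z \<Rightarrow> real) \<Rightarrow> nat" where
  "N_plus Z C P = Min ((\<lambda>c. card {z \<in> Z. P c z > 0}) ` C)"

definition mle_teacher ::
    "'z set \<Rightarrow> 'c set \<Rightarrow> ('c \<Rightarrow> 'z \<Rightarrow> real) \<Rightarrow> ('c \<Rightarrow> 'z set) \<Rightarrow> bool" where
  "mle_teacher Z C P T \<longleftrightarrow>
     T \<in> C \<rightarrow> Pow Z \<and>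
     (\<forall>c\<^sub>0\<in>C. card (T c\<^sub>0) \<le> N_plus Z C P \<and>
        (\<forall>c. is_arg_max (\<lambda>c. sample_likelihood (P c) (T c\<^sub>0)) (\<lambda>c. c \<in> C) c \<longleftrightarrow> c = c\<^sub>0))"

definition MLE_TD :: "'z set \<Rightarrow> ('c \<Rightarrow> 'z \<Rightarrow> bool) \<Rightarrow> 'c set \<Rightarrow> enat" where
  "MLE_TD Z cons C =
     Inf {enat (map_order C T) |P T. mle_learner Z cons C P \<and> mle_teacher Z C P T}"

definition antichain_mapping ::
    "'z set \<Rightarrow> ('c \<Rightarrow> 'z \<Rightarrow> bool) \<Rightarrow> 'c set \<Rightarrow> ('c \<Rightarrow> 'z set) \<Rightarrow> bool" where
  "antichain_mapping Z cons C T \<longleftrightarrow>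
     T \<in> C \<rightarrow> Pow Z \<and>
     (\<forall>c\<in>C. consistent_with cons c (T c)) \<and>
     (\<forall>c\<^sub>1\<in>C. \<forall>c\<^sub>2\<in>C. c\<^sub>1 \<noteq> c\<^sub>2 \<longrightarrow> \<not> T c\<^sub>1 \<subseteq> T c\<^sub>2)"

definition AN :: "'z set \<Rightarrow> ('c \<Rightarrow> 'z \<Rightarrow> bool) \<Rightarrow> 'c set \<Rightarrow> enat" where
  "AN Z cons C = Inf {enat (map_order C T) |T. antichain_mapping Z cons C T}"

definition clash_free ::
    "'z set \<Rightarrow> ('c \<Rightarrow> 'z \<Rightarrow> bool) \<Rightarrow> 'c set \<Rightarrow> ('c \<Rightarrow> 'z set) \<Rightarrow> bool" where
  "clash_free Z cons C T \<longleftrightarrow>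
     T \<in> C \<rightarrow> Pow Z \<and>
     (\<forall>c\<in>C. consistent_with cons c (T c)) \<and>
     (\<forall>c\<^sub>1\<in>C. \<forall>c\<^sub>2\<in>C. c\<^sub>1 \<noteq> c\<^sub>2 \<longrightarrow>
        \<not> consistent_with cons c\<^sub>1 (T c\<^sub>2) \<or> \<not> consistent_with cons c\<^sub>2 (T c\<^sub>1))"

definition NC_TD :: "'z set \<Rightarrow> ('c \<Rightarrow> 'z \<Rightarrow> bool) \<Rightarrow> 'c set \<Rightarrow> enat" where
  "NC_TD Z cons C = Inf {enat (map_order C T) |T. clash_free Z cons C T}"

definition labelled_examples :: "'a set \<Rightarrow> ('a \<times> nat) set" where
  "labelled_examples X = X \<times> {0, 1}"

definition label_consistent :: "'a set \<Rightarrow> 'a \<times> nat \<Rightarrow> bool" where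
  "label_consistent c = (\<lambda>(x, b). (b = 1 \<and> x \<in> c) \<or> (b = 0 \<and> x \<notin> c))"

end

theory Submission
  imports Defs
begin

text \<open>
  Every concept has the same number \<open>m\<close> of consistent examples. Given an antichain mapping \<open>T\<close>, let
  the learner put weight \<open>1\<close> on the examples in \<open>T c\<close> and a tiny weight \<open>\<delta>\<close> on the other examples
  consistent with \<open>c\<close>. For \<open>c \<noteq> c\<^sub>0\<close> the set \<open>T c\<^sub>0\<close> contains an example outside \<open>T c\<close> and misses one
  in \<open>T c\<close>; in every enumeration of \<open>T c\<^sub>0\<close> the former is drawn while the latter is still available,
  which has conditional probability at most \<open>\<delta>\<close> under \<open>c\<close>. Under \<open>c\<^sub>0\<close> each enumeration has
  probability at least \<open>m\<^sup>-\<^sup>m\<close>, so \<open>T\<close> itself is a teacher if \<open>\<delta>\<close> is smaller than this.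

  A clash-free mapping stays clash-free when its sets are enlarged to consistent sets of the same
  size, and a clash-free mapping into sets of one size is an antichain mapping.
\<close>

section \<open>Likelihood bounds for sampling without replacement\<close>

text \<open>The entries up to position \<open>i\<close> are distinct and avoid \<open>W\<close>, so
  the left side is the mass of one subset of \<open>Z\<close>. A singleton \<open>W\<close> serves
  as an example that is never drawn.\<close>

lemma sum_take_le_one:
  fixes q :: "'z \<Rightarrow> real"
  assumes "finite Z" "\<forall>z\<in>Z. q z \<ge> 0" "sum q Z = 1"
    and "distinct zs" "set zs \<subseteq> Z" "i < length zs" "W \<subseteq> Z - set zs"
  shows "(\<Sum>j<i. q (zs ! j)) + q (zs ! i) + sum q W \<le> 1"
proof -
  have inj: "inj_on ((!) zs) {..<Suc i}"
    using assms(4,6) by (auto simp: inj_on_def nth_eq_iff_index_eq)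
  have sub: "(!) zs ` {..<Suc i} \<subseteq> set zs"
    using assms(6) by auto
  have "(\<Sum>j<i. q (zs ! j)) + q (zs ! i) = sum q ((!) zs ` {..<Suc i})"
    by (subst sum.reindex[OF inj]) simp
  also have "\<dots> + sum q W = sum q ((!) zs ` {..<Suc i} \<union> W)"
    using assms(1,7) sub finite_subset[OF assms(7)] by (intro sum.union_disjoint[symmetric]) auto
  also have "\<dots> \<le> sum q Z"
    using assms sub by (intro sum_mono2) auto
  finally show ?thesis
    using assms(3) by simp
qed

text \<open>The denominator lies between \<open>q (zs ! i)\<close> and 1. If it is 0, then
  \<open>q (zs ! i) = 0\<close> and the quotient is 0 by convention, so no assumption on the support
  is made.\<close>

lemma draw_probability_bounds:
  fixes q :: "'z \<Rightarrow> real"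
  assumes "finite Z" "\<forall>z\<in>Z. q z \<ge> 0" "sum q Z = 1"
    and "distinct zs" "set zs \<subseteq> Z" "i < length zs"
  shows "q (zs ! i) \<le> q (zs ! i) / (1 - (\<Sum>j<i. q (zs ! j)))"
    and "q (zs ! i) / (1 - (\<Sum>j<i. q (zs ! j))) \<le> 1"
proof -
  let ?D = "1 - (\<Sum>j<i. q (zs ! j))"
  have le: "q (zs ! i) \<le> ?D"
    using sum_take_le_one[OF assms, of "{}"] by simp
  have nn: "q (zs ! i) \<ge> 0"
    using assms by (metis nth_mem subsetD)
  have "(\<Sum>j<i. q (zs ! j)) \<ge> 0"
    using assms by (intro sum_nonneg) (metis lessThan_iff nth_mem order.strict_trans subsetD)
  then have D1: "?D \<le> 1" by simp
  show "q (zs ! i) / ?D \<le> 1"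
    using le nn by (cases "?D = 0") (auto simp: divide_le_eq_1)
  show "q (zs ! i) \<le> q (zs ! i) / ?D"
  proof (cases "?D = 0")
    case False
    then have "?D > 0" using le nn by linarith
    then show ?thesis
      using D1 nn by (simp add: pos_le_divide_eq mult_left_le)
  qed (use le in auto)
qed

text \<open>Replacing every denominator by 1 does not increase any factor, and there are
  \<open>fact (card A)\<close> enumerations.\<close>

lemma sample_likelihood_ge:
  fixes q :: "'z \<Rightarrow> real"
  assumes "finite Z" "\<forall>z\<in>Z. q z \<ge> 0" "sum q Z = 1" "A \<subseteq> Z"
  shows "fact (card A) * (\<Prod>z\<in>A. q z) \<le> sample_likelihood q A"
proof -
  have fin: "finite A" using assms by (metis finite_subset)
  have "(\<Prod>z\<in>A. q z) \<le> (\<Prod>i<length zs. q (zs ! i) / (1 - (\<Sum>j<i. q (zs ! j))))"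
    if "zs \<in> permutations_of_set A" for zs
  proof -
    from that have zs: "set zs = A" "distinct zs" by (auto simp: permutations_of_set_def)
    have "(\<Prod>z\<in>A. q z) = (\<Prod>i<length zs. q (zs ! i))"
      using prod.reindex_bij_betw[OF bij_betw_nth[OF zs(2) refl refl], of q] zs(1) by simp
    also have "\<dots> \<le> (\<Prod>i<length zs. q (zs ! i) / (1 - (\<Sum>j<i. q (zs ! j))))"
      using draw_probability_bounds(1)[OF assms(1-3) zs(2)] zs(1) assms(2,4)
      by (intro prod_mono) (auto dest: nth_mem)
    finally show ?thesis .
  qed
  then have "(\<Sum>zs\<in>permutations_of_set A. \<Prod>z\<in>A. q z) \<le> sample_likelihood q A"
    unfolding sample_likelihood_def by (rule sum_mono)
  then show ?thesis
    using fin by simp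
qed

text \<open>Since \<open>w\<close> is never drawn, mass at least \<open>q w\<close> remains whenever
  \<open>z\<close> is drawn.\<close>

lemma sample_likelihood_le:
  fixes q :: "'z \<Rightarrow> real"
  assumes "finite Z" "\<forall>z\<in>Z. q z \<ge> 0" "sum q Z = 1" "A \<subseteq> Z"
    and "z \<in> A" "w \<in> Z - A" "q w > 0" "q z \<le> \<delta> * q w"
  shows "sample_likelihood q A \<le> fact (card A) * \<delta>"
proof -
  have fin: "finite A" using assms by (metis finite_subset)
  have z_nonneg: "q z \<ge> 0" using assms(2,4,5) by blast
  then have "0 \<le> \<delta> * q w" using assms(8) by simp
  then have \<delta>: "\<delta> \<ge> 0" using assms(7) by (simp add: zero_le_mult_iff)
  have "(\<Prod>i<length zs. q (zs ! i) / (1 - (\<Sum>j<i. q (zs ! j)))) \<le> \<delta>"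
    if "zs \<in> permutations_of_set A" for zs
  proof -
    let ?f = "\<lambda>i. q (zs ! i) / (1 - (\<Sum>j<i. q (zs ! j)))"
    from that have zs: "set zs = A" "distinct zs" by (auto simp: permutations_of_set_def)
    have sub: "set zs \<subseteq> Z" using zs assms(4) by simp
    note bounds = draw_probability_bounds[OF assms(1-3) zs(2) sub]
    have nn: "?f i \<ge> 0" if "i < length zs" for i
      using bounds(1)[OF that] assms(2) sub that by (meson nth_mem order_trans subsetD)
    obtain k where k: "k < length zs" "zs ! k = z"
      using assms(5) zs(1) by (metis in_set_conv_nth)
    have "(\<Sum>j<k. q (zs ! j)) + q z + q w \<le> 1"
      using sum_take_le_one[OF assms(1-3) zs(2) sub k(1), of "{w}"] assms(6) zs(1) k(2) by simp
    then have D: "q w \<le> 1 - (\<Sum>j<k. q (zs ! j))"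
      using z_nonneg by simp
    then have "\<delta> * q w \<le> \<delta> * (1 - (\<Sum>j<k. q (zs ! j)))"
      using \<delta> by (rule mult_left_mono)
    then have "?f k \<le> \<delta>"
      using D assms(7,8) k(2) by (simp add: pos_divide_le_eq)
    \<comment> \<open>Only the factor at which \<open>z\<close> is drawn matters; the others lie
      between 0 and 1.\<close>
    have "(\<Prod>i<length zs. ?f i) = ?f k * (\<Prod>i\<in>{..<length zs} - {k}. ?f i)"
      using k(1) by (intro prod.remove) auto
    also have "\<dots> \<le> ?f k * 1"
      using nn bounds(2) k(1) by (intro mult_left_mono prod_le_1) auto
    finally show ?thesis
      using \<open>?f k \<le> \<delta>\<close> by simp
  qed
  then have "sample_likelihood q A \<le> (\<Sum>zs\<in>permutations_of_set A. \<delta>)"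
    unfolding sample_likelihood_def by (rule sum_mono)
  then show ?thesis
    using fin by simp
qed

section \<open>Two-level distributions\<close>

definition two_level_weight :: "real \<Rightarrow> 'z set \<Rightarrow> 'z set \<Rightarrow> 'z \<Rightarrow> real" where
  "two_level_weight \<delta> A B z = (if z \<in> A then 1 else if z \<in> B then \<delta> else 0)"

text \<open>Summing over \<open>B\<close> gives the full normaliser when
  \<open>A \<subseteq> B\<close>, because the weight then vanishes off \<open>B\<close>.\<close>

definition two_level_prob :: "real \<Rightarrow> 'z set \<Rightarrow> 'z set \<Rightarrow> 'z \<Rightarrow> real" where
  "two_level_prob \<delta> A B z = two_level_weight \<delta> A B z / sum (two_level_weight \<delta> A B) B"

context
  fixes A B Z :: "'z set" and \<delta> :: real
  assumes fin: "finite Z" and AB: "A \<subseteq> B" and BZ: "B \<subseteq> Z" and A_ne: "A \<noteq> {}"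
    and \<delta>: "0 < \<delta>" "\<delta> \<le> 1"
begin

lemma sum_two_level_weight_pos: "0 < sum (two_level_weight \<delta> A B) B"
  using AB BZ A_ne \<delta> finite_subset[OF BZ fin]
  by (intro sum_pos) (auto simp: two_level_weight_def)

lemma sum_two_level_weight_le: "sum (two_level_weight \<delta> A B) B \<le> real (card B)"
  using \<delta> sum_bounded_above[of B "two_level_weight \<delta> A B" 1]
  by (auto simp: two_level_weight_def)

lemma two_level_prob_nonneg: "two_level_prob \<delta> A B z \<ge> 0"
  using sum_two_level_weight_pos \<delta> by (auto simp: two_level_prob_def two_level_weight_def)

lemma two_level_prob_pos_iff: "two_level_prob \<delta> A B z > 0 \<longleftrightarrow> z \<in> B"
  using sum_two_level_weight_pos \<delta> AB by (auto simp: two_level_prob_def two_level_weight_def)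

lemma sum_two_level_prob: "sum (two_level_prob \<delta> A B) Z = 1"
proof -
  have "sum (two_level_prob \<delta> A B) Z = sum (two_level_prob \<delta> A B) B"
    using fin AB BZ
    by (intro sum.mono_neutral_right) (auto simp: two_level_prob_def two_level_weight_def)
  then show ?thesis
    using sum_two_level_weight_pos
    by (simp add: two_level_prob_def sum_divide_distrib[symmetric])
qed

text \<open>The bound is free of \<open>\<delta>\<close>, so \<open>\<delta>\<close> can later be
  chosen small relative to it.\<close>

lemma two_level_prob_ge: "z \<in> A \<Longrightarrow> 1 / real (card B) \<le> two_level_prob \<delta> A B z"
  using sum_two_level_weight_pos sum_two_level_weight_le
  by (auto simp: two_level_prob_def two_level_weight_def intro!: divide_left_mono)

lemma two_level_prob_ratio:
  "z \<notin> A \<Longrightarrow> w \<in> A \<Longrightarrow> two_level_prob \<delta> A B z \<le> \<delta> * two_level_prob \<delta> A B w"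
  using sum_two_level_weight_pos \<delta>
  by (auto simp: two_level_prob_def two_level_weight_def)

end

section \<open>From antichain mappings to teachers\<close>

text \<open>The common size \<open>m\<close> makes all supports equally large, so
  \<open>N_plus\<close> is \<open>m\<close>, which bounds the size of every consistent set
  \<open>T c\<close>.\<close>

lemma antichain_mapping_is_teacher:
  assumes "finite Z" "finite C" "card C \<ge> 2"
    and card_cons: "\<forall>c\<in>C. card {z \<in> Z. cons c z} = m"
    and T: "antichain_mapping Z cons C T"
  obtains P where "mle_learner Z cons C P" "mle_teacher Z C P T"
proof -
  define B where "B c = {z \<in> Z. cons c z}" for c
  have BZ: "B c \<subseteq> Z" for c by (auto simp: B_def)
  have TB: "T c \<subseteq> B c" if "c \<in> C" for c
    using T that by (auto simp: antichain_mapping_def consistent_with_def B_def Pi_def)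
  have anti: "\<not> T c \<subseteq> T c'" if "c \<in> C" "c' \<in> C" "c \<noteq> c'" for c c'
    using T that by (auto simp: antichain_mapping_def)
  have T_ne: "T c \<noteq> {}" if "c \<in> C" for c
  proof -
    \<comment> \<open>An empty \<open>T c\<close> would be contained in the set of this second
      concept.\<close>
    obtain c' where "c' \<in> C" "c' \<noteq> c"
      using assms(2,3) that by (metis card_le_Suc0_iff_eq not_less_eq_eq numeral_2_eq_2)
    then show ?thesis using anti that by blast
  qed
  have finB: "finite (B c)" for c using BZ assms(1) by (metis finite_subset)
  have cardB: "card (B c) = m" if "c \<in> C" for c
    using card_cons that by (simp add: B_def)
  have card_T: "card (T c) \<le> m" if "c \<in> C" for c
    using card_mono[OF finB TB[OF that]] cardB that by simp
  obtain c\<^sub>1 where c\<^sub>1: "c\<^sub>1 \<in> C"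
    using assms(3) by fastforce
  have "m > 0"
    using T_ne[OF c\<^sub>1] TB[OF c\<^sub>1] cardB[OF c\<^sub>1] finB[of c\<^sub>1] by (metis card_gt_0_iff subset_empty)
  \<comment> \<open>The value \<open>1 / real m ^ m\<close> bounds from below a product of at most
    \<open>m\<close> likelihoods, each at least \<open>1 / real m\<close>.\<close>
  then obtain \<delta> where "0 < \<delta>" "\<delta> < min 1 (1 / real m ^ m)"
    using dense[of 0 "min 1 (1 / real m ^ m)"] by auto
  then have \<delta>: "0 < \<delta>" "\<delta> \<le> 1" "\<delta> < 1 / real m ^ m"
    by auto
  define P where "P c = two_level_prob \<delta> (T c) (B c)" for c
  note prob = assms(1) TB BZ T_ne \<delta>(1,2)
  have P_nonneg: "P c z \<ge> 0" and P_pos: "P c z > 0 \<longleftrightarrow> z \<in> B c" and P_sum: "sum (P c) Z = 1"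
    if "c \<in> C" for c z
    unfolding P_def
    using two_level_prob_nonneg[OF prob] two_level_prob_pos_iff[OF prob] sum_two_level_prob[OF prob]
      that by blast+
  have learner: "mle_learner Z cons C P"
    using P_nonneg P_pos P_sum
    unfolding mle_learner_def B_def by (force simp: order.order_iff_strict)
  have "{z \<in> Z. P c z > 0} = B c" if "c \<in> C" for c
    using P_pos[OF that] BZ[of c] by blast
  then have "card {z \<in> Z. P c z > 0} = m" if "c \<in> C" for c
    using cardB that by simp
  then have "(\<lambda>c. card {z \<in> Z. P c z > 0}) ` C = {m}"
    using c\<^sub>1 by force
  then have N: "N_plus Z C P = m"
    by (simp add: N_plus_def)
  have less: "sample_likelihood (P c) (T c\<^sub>0) < sample_likelihood (P c\<^sub>0) (T c\<^sub>0)"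
    if c: "c \<in> C" "c\<^sub>0 \<in> C" "c \<noteq> c\<^sub>0" for c c\<^sub>0
  proof -
    have TZ: "T c \<subseteq> Z" "T c\<^sub>0 \<subseteq> Z" using TB BZ c by blast+
    obtain z where z: "z \<in> T c\<^sub>0" "z \<notin> T c" using anti[of c\<^sub>0 c] c by blast
    obtain w where w: "w \<in> T c" "w \<notin> T c\<^sub>0" using anti[of c c\<^sub>0] c by blast
    have "P c z \<le> \<delta> * P c w"
      unfolding P_def using two_level_prob_ratio[OF prob] c z w by blast
    moreover have "P c w > 0"
      using P_pos TB c w by blast
    ultimately have "sample_likelihood (P c) (T c\<^sub>0) \<le> fact (card (T c\<^sub>0)) * \<delta>"
      using c z w TZ
      by (intro sample_likelihood_le[OF assms(1) _ P_sum, where z = z and w = w]) (auto simp: P_nonneg)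
    \<comment> \<open>Both bounds carry the same number of enumerations, so only the bounds per
      enumeration are compared.\<close>
    also have "\<dots> < fact (card (T c\<^sub>0)) * (\<Prod>z\<in>T c\<^sub>0. P c\<^sub>0 z)"
    proof (intro mult_strict_left_mono)
      have "\<delta> < (1 / real m) ^ m"
        using \<delta>(3) by (simp add: power_one_over)
      also have "\<dots> \<le> (1 / real m) ^ card (T c\<^sub>0)"
        using \<open>m > 0\<close> card_T[OF c(2)] by (intro power_decreasing) auto
      also have "\<dots> = (\<Prod>z\<in>T c\<^sub>0. 1 / real m)"
        by simp
      also have "\<dots> \<le> (\<Prod>z\<in>T c\<^sub>0. P c\<^sub>0 z)"
        unfolding P_def using two_level_prob_ge[OF prob] c cardB by (intro prod_mono) fastforce
      finally show "\<delta> < (\<Prod>z\<in>T c\<^sub>0. P c\<^sub>0 z)" .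
    qed simp
    also have "\<dots> \<le> sample_likelihood (P c\<^sub>0) (T c\<^sub>0)"
      using c TZ by (intro sample_likelihood_ge[OF assms(1) _ P_sum]) (auto simp: P_nonneg)
    finally show ?thesis .
  qed
  have "is_arg_max (\<lambda>c. sample_likelihood (P c) (T c\<^sub>0)) (\<lambda>c. c \<in> C) c \<longleftrightarrow> c = c\<^sub>0"
    if "c\<^sub>0 \<in> C" for c c\<^sub>0
    using less that unfolding is_arg_max_def by (metis less_asym)
  then have "mle_teacher Z C P T"
    using T card_T N by (auto simp: mle_teacher_def antichain_mapping_def)
  with learner show thesis by (rule that)
qed

text \<open>The attainable orders are included in one another, so an infinite \<open>AN\<close>
  needs no separate case.\<close>

lemma MLE_TD_le_AN:
  assumes "finite Z" "finite C" "card C \<ge> 2"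
    and "\<forall>c\<in>C. card {z \<in> Z. cons c z} = m"
  shows "MLE_TD Z cons C \<le> AN Z cons C"
  unfolding MLE_TD_def AN_def
proof (rule Inf_superset_mono, rule subsetI, clarify)
  fix T assume "antichain_mapping Z cons C T"
  then obtain P where "mle_learner Z cons C P" "mle_teacher Z C P T"
    by (rule antichain_mapping_is_teacher[OF assms])
  then show "\<exists>P T'. enat (map_order C T) = enat (map_order C T')
      \<and> mle_learner Z cons C P \<and> mle_teacher Z C P T'"
    by blast
qed

section \<open>From clash-free to antichain mappings\<close>

lemma clash_free_imp_antichain_mapping:
  assumes "finite Z" "finite C" "C \<noteq> {}"
    and card_cons: "\<forall>c\<in>C. card {z \<in> Z. cons c z} = m"
    and T: "clash_free Z cons C T"
  obtains T' where "antichain_mapping Z cons C T'" "map_order C T' = map_order C T"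
proof -
  define d where "d = map_order C T"
  have TB: "T c \<subseteq> {z \<in> Z. cons c z}" if "c \<in> C" for c
    using T that by (auto simp: clash_free_def consistent_with_def Pi_def)
  have le_m: "card (T c) \<le> m" if "c \<in> C" for c
    using card_mono[OF _ TB[OF that]] card_cons that assms(1) by simp
  have le_d: "card (T c) \<le> d" if "c \<in> C" for c
    using assms(2) that by (auto simp: d_def map_order_def)
  have "d \<le> m"
    using assms(2,3) le_m by (auto simp: d_def map_order_def)
  \<comment> \<open>Padding up to the order \<open>d\<close> is possible because \<open>m\<close>
    consistent examples are available and \<open>d \<le> m\<close>.\<close>
  have "\<exists>D. T c \<subseteq> D \<and> D \<subseteq> {z \<in> Z. cons c z} \<and> card D = d" if "c \<in> C" for c
    using exists_subset_between[OF _ _ TB[OF that], of d] le_d[OF that] card_cons that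
      \<open>d \<le> m\<close> assms(1) by auto
  then obtain T' where T': "\<And>c. c \<in> C \<Longrightarrow> T c \<subseteq> T' c"
      "\<And>c. c \<in> C \<Longrightarrow> T' c \<subseteq> {z \<in> Z. cons c z}" "\<And>c. c \<in> C \<Longrightarrow> card (T' c) = d"
    by metis
  have "\<not> T' c\<^sub>1 \<subseteq> T' c\<^sub>2" if c: "c\<^sub>1 \<in> C" "c\<^sub>2 \<in> C" "c\<^sub>1 \<noteq> c\<^sub>2" for c\<^sub>1 c\<^sub>2
  proof
    assume "T' c\<^sub>1 \<subseteq> T' c\<^sub>2"
    moreover have "finite (T' c\<^sub>2)"
      using T'(2)[OF c(2)] assms(1) by (auto intro: finite_subset)
    ultimately have "T' c\<^sub>1 = T' c\<^sub>2"
      using T'(3) c by (intro card_subset_eq) auto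
    \<comment> \<open>The common padded set is consistent with both concepts and contains both
      original sets, which is a clash.\<close>
    then have "consistent_with cons c\<^sub>1 (T c\<^sub>2)" "consistent_with cons c\<^sub>2 (T c\<^sub>1)"
      using T'(1,2) c unfolding consistent_with_def by blast+
    then show False
      using T c by (auto simp: clash_free_def)
  qed
  then have "antichain_mapping Z cons C T'"
    using T'(2) by (fastforce simp: antichain_mapping_def consistent_with_def)
  moreover have "(\<lambda>c. card (T' c)) ` C = {d}"
    using T'(3) assms(3) by auto
  then have "map_order C T' = map_order C T"
    by (simp add: d_def map_order_def)
  ultimately show thesis by (rule that)
qed

lemma AN_le_NC_TD:
  assumes "finite Z" "finite C" "C \<noteq> {}"
    and "\<forall>c\<in>C. card {z \<in> Z. cons c z} = m"
  shows "AN Z cons C \<le> NC_TD Z cons C"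
  unfolding AN_def NC_TD_def
proof (rule Inf_superset_mono, rule subsetI, clarify)
  fix T assume "clash_free Z cons C T"
  then obtain T' where "antichain_mapping Z cons C T'" "map_order C T' = map_order C T"
    by (rule clash_free_imp_antichain_mapping[OF assms])
  then show "\<exists>T'. enat (map_order C T) = enat (map_order C T') \<and> antichain_mapping Z cons C T'"
    by metis
qed

text \<open>Each point has exactly one correct label, so the consistent examples form the graph of
  the indicator function of \<open>c\<close> on \<open>X\<close>.\<close>

lemma card_label_consistent:
  "card {z \<in> labelled_examples X. label_consistent c z} = card X"
proof -
  have "{z \<in> labelled_examples X. label_consistent c z} = (\<lambda>x. (x, if x \<in> c then 1 else 0)) ` X"
    by (auto simp: labelled_examples_def label_consistent_def split: if_splits)
  then show ?thesis
    by (simp add: card_image inj_on_def)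
qed

theorem theorem5p10:
  fixes X :: "'a set" and C :: "'a set set"
  assumes "finite X" and "X \<noteq> {}"
    and "C \<subseteq> Pow X" and "card C \<ge> 2"
  shows "MLE_TD (labelled_examples X) label_consistent C
           \<le> AN (labelled_examples X) label_consistent C
       \<and> MLE_TD (labelled_examples X) label_consistent C
           \<le> NC_TD (labelled_examples X) label_consistent C"
proof -
  have fin: "finite (labelled_examples X)" "finite C" "C \<noteq> {}"
    using assms by (auto simp: labelled_examples_def intro: finite_subset)
  have card: "\<forall>c\<in>C. card {z \<in> labelled_examples X. label_consistent c z} = card X"
    by (simp add: card_label_consistent)
  show ?thesis
    using MLE_TD_le_AN[OF fin(1,2) assms(4) card] AN_le_NC_TD[OF fin card] by (auto intro: order_trans)
qed

end
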